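(* Let $n\geq2$ and let $M$ be a monoid. (i) If $M$ is infinite, then $M\wr\mathrm{Sing}_n$ is finitely generated if and only if $M$ is finitely generated (as a semigroup) and the diagonal action of $M$ on $M\times M$ is finitely generated. (ii) If $M\wr\mathrm{Sing}_n$ is not finitely generated (for example, if $M$ is an infinite group), then $\mathrm{rank}(M\wr\mathrm{Sing}_n)=|M|$; if $M/\mathscr L$ is also a chain, then $\mathrm{idrank}(M\wr\mathrm{Sing}_n)=|M|$.
   Context: $\mathcal T_n$ is the monoid of all maps $\{1,\ldots,n\}\to\{1,\ldots,n\}$, written on the right and composed from left to right, and $\mathrm{Sing}_n$ is its subsemigroup of all non-bijective maps. The wreath product $M\wr\mathrm{Sing}_n$ is the set $M^n\times\mathrm{Sing}_n$ with product $$((a_1,\ldots,a_n),\alpha)((b_1,\ldots,b_n),\beta)=((a_1b_{1\alpha},\ldots,a_nb_{n\alpha}),\alpha\beta).$$ Finite generation is as a semigroup. The (right) diagonal action of $M$ on the set $M\times M$ is $(a,b)\cdot c=(ac,bc)$; it is finitely generated if there is a finite subset $\Omega\subseteq M\times M$ with $\Omega\cdot M=M\times M$. The rank of a semigroup $T$, $\mathrm{rank}(T)$, is the smallest cardinality of a set generating $T$ as a semigroup; if $T$ is generated by its idempotents, $\mathrm{idrank}(T)$ is the smallest cardinality of a generating set for $T$ consisting of idempotents. (When $M/\mathscr L$ is a chain, $M\wr\mathrm{Sing}_n$ is idempotent-generated.) On $M$, $a\leq_{\mathscr L}b$ means $a\in Mb$; $\mathscr L$ is the equivalence $\leq_{\mathscr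 L}\cap\geq_{\mathscr L}$, and $M/\mathscr L$ is the set of $\mathscr L$-classes with the partial order induced by $\leq_{\mathscr L}$. *)

theory Defs
  imports "HOL-Algebra.Group"
begin

unbundle cardinal_syntax

section \<open>Semigroups as a carrier set with a binary operation\<close>

text \<open>
  \<open>HOL-Algebra\<close> structures carry an identity, which the semigroup
  \<open>M \<wreath> Sing\<^sub>n\<close> lacks; a semigroup is therefore given here
  by its carrier \<open>S\<close> and its operation \<open>f\<close>.
\<close>

inductive_set sgp_span :: "('a \<Rightarrow> 'a \<Rightarrow> 'a) \<Rightarrow> 'a set \<Rightarrow> 'a set"
  for f :: "'a \<Rightarrow> 'a \<Rightarrow> 'a" and A :: "'a set"
where
  incl: "x \<in> A \<Longrightarrow> x \<in> sgp_span f A"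
| prod: "x \<in> sgp_span f A \<Longrightarrow> y \<in> sgp_span f A \<Longrightarrow> f x y \<in> sgp_span f A"

definition sgp_generates :: "'a set \<Rightarrow> ('a \<Rightarrow> 'a \<Rightarrow> 'a) \<Rightarrow> 'a set \<Rightarrow> bool" where
  "sgp_generates S f A \<longleftrightarrow> A \<subseteq> S \<and> sgp_span f A = S"

definition sgp_fin_gen :: "'a set \<Rightarrow> ('a \<Rightarrow> 'a \<Rightarrow> 'a) \<Rightarrow> bool" where
  "sgp_fin_gen S f \<longleftrightarrow> (\<exists>A. finite A \<and> sgp_generates S f A)"

definition idempotents :: "'a set \<Rightarrow> ('a \<Rightarrow> 'a \<Rightarrow> 'a) \<Rightarrow> 'a set" where
  "idempotents S f = {e \<in> S. f e e = e}"

definition idempotent_generated :: "'a set \<Rightarrow> ('a \<Rightarrow> 'a \<Rightarrow> 'a) \<Rightarrow> bool" where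
  "idempotent_generated S f \<longleftrightarrow> sgp_generates S f (idempotents S f)"

text \<open>
  The smallest cardinality of a member of a family of sets. Ranks may be
  infinite, so cardinalities are the cardinal orders \<open>|A|\<close> rather than
  natural numbers, and are compared up to \<open>=o\<close>. The value is meaningful
  only for a nonempty family.
\<close>

definition least_card :: "'a set set \<Rightarrow> 'a rel" where
  "least_card F = |SOME A. A \<in> F \<and> (\<forall>B\<in>F. |A| \<le>o |B| )|"

lemma least_card:
  assumes "F \<noteq> {}"
  shows "\<exists>A\<in>F. least_card F = |A| \<and> (\<forall>B\<in>F. |A| \<le>o |B| )"
proof -
  have "\<exists>r\<in>card_of ` F. \<forall>r'\<in>card_of ` F. r \<le>o r'"
    using assms by (intro exists_minim_Card_order) (auto simp: card_of_Card_order)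
  then have "\<exists>A. A \<in> F \<and> (\<forall>B\<in>F. |A| \<le>o |B| )" by auto
  from someI_ex[OF this] show ?thesis unfolding least_card_def by blast
qed

definition sgp_rank :: "'a set \<Rightarrow> ('a \<Rightarrow> 'a \<Rightarrow> 'a) \<Rightarrow> 'a rel" where
  "sgp_rank S f = least_card {A. sgp_generates S f A}"

text \<open>Meaningful only if \<open>S\<close> is idempotent-generated.\<close>

definition sgp_idrank :: "'a set \<Rightarrow> ('a \<Rightarrow> 'a \<Rightarrow> 'a) \<Rightarrow> 'a rel" where
  "sgp_idrank S f = least_card {A. A \<subseteq> idempotents S f \<and> sgp_generates S f A}"


section \<open>The wreath product\<close>

definition Trans :: "nat \<Rightarrow> (nat \<Rightarrow> nat) set" where
  "Trans n = {1..n} \<rightarrow>\<^sub>E {1..n}"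

definition Sing :: "nat \<Rightarrow> (nat \<Rightarrow> nat) set" where
  "Sing n = {\<alpha> \<in> Trans n. \<not> bij_betw \<alpha> {1..n} {1..n}}"

definition wr_Sing :: "('a, 'b) monoid_scheme \<Rightarrow> nat \<Rightarrow> ((nat \<Rightarrow> 'a) \<times> (nat \<Rightarrow> nat)) set" where
  "wr_Sing M n = ({1..n} \<rightarrow>\<^sub>E carrier M) \<times> Sing n"

text \<open>
  Maps act on the right: \<open>i\<alpha>\<close> is \<open>\<alpha> i\<close>, and \<open>\<alpha>\<beta>\<close> (first \<open>\<alpha>\<close>, then \<open>\<beta>\<close>)
  is \<open>compose {1..n} \<beta> \<alpha>\<close>.
\<close>

definition wr_mult :: "('a, 'b) monoid_scheme \<Rightarrow> nat \<Rightarrow>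
    (nat \<Rightarrow> 'a) \<times> (nat \<Rightarrow> nat) \<Rightarrow> (nat \<Rightarrow> 'a) \<times> (nat \<Rightarrow> nat) \<Rightarrow> (nat \<Rightarrow> 'a) \<times> (nat \<Rightarrow> nat)" where
  "wr_mult M n = (\<lambda>(a, \<alpha>) (b, \<beta>).
     (\<lambda>i\<in>{1..n}. a i \<otimes>\<^bsub>M\<^esub> b (\<alpha> i), compose {1..n} \<beta> \<alpha>))"

lemma wr_mult_closed:
  assumes "monoid M" "x \<in> wr_Sing M n" "y \<in> wr_Sing M n"
  shows "wr_mult M n x y \<in> wr_Sing M n"
proof -
  obtain a \<alpha> b \<beta> where xy: "x = (a, \<alpha>)" "y = (b, \<beta>)" by (meson surj_pair)
  have a: "a \<in> {1..n} \<rightarrow>\<^sub>E carrier M" "b \<in> {1..n} \<rightarrow>\<^sub>E carrier M"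
    and T: "\<alpha> \<in> {1..n} \<rightarrow>\<^sub>E {1..n}" "\<beta> \<in> {1..n} \<rightarrow>\<^sub>E {1..n}"
    and nb: "\<not> bij_betw \<alpha> {1..n} {1..n}"
    using assms xy by (auto simp: wr_Sing_def Sing_def Trans_def)
  have c: "compose {1..n} \<beta> \<alpha> \<in> {1..n} \<rightarrow>\<^sub>E {1..n}"
    unfolding compose_def
    by (intro restrict_PiE_iff[THEN iffD2] ballI PiE_mem[OF T(2)] PiE_mem[OF T(1)])
  have "\<not> bij_betw (compose {1..n} \<beta> \<alpha>) {1..n} {1..n}"
  proof
    assume "bij_betw (compose {1..n} \<beta> \<alpha>) {1..n} {1..n}"
    then have "inj_on \<alpha> {1..n}"
      by (intro inj_onI) (metis bij_betw_imp_inj_on compose_eq inj_onD)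
    moreover have "\<alpha> ` {1..n} \<subseteq> {1..n}" using PiE_mem[OF T(1)] by blast
    ultimately show False
      using nb by (simp add: bij_betw_def endo_inj_surj)
  qed
  moreover have "(\<lambda>i\<in>{1..n}. a i \<otimes>\<^bsub>M\<^esub> b (\<alpha> i)) \<in> {1..n} \<rightarrow>\<^sub>E carrier M"
    by (intro restrict_PiE_iff[THEN iffD2] ballI monoid.m_closed[OF assms(1)]
        PiE_mem[OF a(1)] PiE_mem[OF a(2)] PiE_mem[OF T(1)])
  ultimately show ?thesis
    using c by (simp add: xy wr_mult_def wr_Sing_def Sing_def Trans_def)
qed

lemma wr_mult_assoc:
  assumes "monoid M" "x \<in> wr_Sing M n" "y \<in> wr_Sing M n" "z \<in> wr_Sing M n"
  shows "wr_mult M n (wr_mult M n x y) z = wr_mult M n x (wr_mult M n y z)"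
proof -
  obtain a \<alpha> b \<beta> c \<gamma> where xyz: "x = (a, \<alpha>)" "y = (b, \<beta>)" "z = (c, \<gamma>)"
    by (meson surj_pair)
  have f: "a \<in> {1..n} \<rightarrow>\<^sub>E carrier M" "b \<in> {1..n} \<rightarrow>\<^sub>E carrier M" "c \<in> {1..n} \<rightarrow>\<^sub>E carrier M"
    "\<alpha> \<in> {1..n} \<rightarrow>\<^sub>E {1..n}" "\<beta> \<in> {1..n} \<rightarrow>\<^sub>E {1..n}"
    using assms xyz by (auto simp: wr_Sing_def Sing_def Trans_def)
  have ab: "\<alpha> i \<in> {1..n}" "\<beta> i \<in> {1..n}" if "i \<in> {1..n}" for i
    using PiE_mem[OF f(4) that] PiE_mem[OF f(5) that] by simp_all
  have abc: "a i \<in> carrier M" "b i \<in> carrier M" "c i \<in> carrier M" if "i \<in> {1..n}" for i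
    using PiE_mem[OF f(1) that] PiE_mem[OF f(2) that] PiE_mem[OF f(3) that] by simp_all
  have "a i \<otimes>\<^bsub>M\<^esub> b (\<alpha> i) \<otimes>\<^bsub>M\<^esub> c (\<beta> (\<alpha> i)) = a i \<otimes>\<^bsub>M\<^esub> (b (\<alpha> i) \<otimes>\<^bsub>M\<^esub> c (\<beta> (\<alpha> i)))"
    if "i \<in> {1..n}" for i
    by (intro monoid.m_assoc[OF assms(1)] abc ab that)
  moreover have "\<alpha> i \<in> {1..n}" if "1 \<le> i" "i \<le> n" for i
    using ab(1) that by simp
  ultimately show ?thesis
    unfolding xyz wr_mult_def compose_def by (simp add: fun_eq_iff restrict_def)
qed


section \<open>The diagonal action and Green's relation L\<close>

definition diag_act :: "('a, 'b) monoid_scheme \<Rightarrow> 'a \<times> 'a \<Rightarrow> 'a \<Rightarrow> 'a \<times> 'a" where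
  "diag_act M = (\<lambda>(a, b) c. (a \<otimes>\<^bsub>M\<^esub> c, b \<otimes>\<^bsub>M\<^esub> c))"

definition diag_act_fin_gen :: "('a, 'b) monoid_scheme \<Rightarrow> bool" where
  "diag_act_fin_gen M \<longleftrightarrow>
     (\<exists>\<Omega>. finite \<Omega> \<and> \<Omega> \<subseteq> carrier M \<times> carrier M \<and>
       {diag_act M p c | p c. p \<in> \<Omega> \<and> c \<in> carrier M} = carrier M \<times> carrier M)"

definition L_le :: "('a, 'b) monoid_scheme \<Rightarrow> 'a \<Rightarrow> 'a \<Rightarrow> bool" where
  "L_le M a b \<longleftrightarrow> (\<exists>m\<in>carrier M. a = m \<otimes>\<^bsub>M\<^esub> b)"

definition L_rel :: "('a, 'b) monoid_scheme \<Rightarrow> 'a rel" where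
  "L_rel M = {(a, b) \<in> carrier M \<times> carrier M. L_le M a b \<and> L_le M b a}"

definition L_class_le :: "('a, 'b) monoid_scheme \<Rightarrow> 'a set \<Rightarrow> 'a set \<Rightarrow> bool" where
  "L_class_le M X Y \<longleftrightarrow> (\<exists>a\<in>X. \<exists>b\<in>Y. L_le M a b)"

definition L_chain :: "('a, 'b) monoid_scheme \<Rightarrow> bool" where
  "L_chain M \<longleftrightarrow>
     (\<forall>X\<in>carrier M // L_rel M. \<forall>Y\<in>carrier M // L_rel M. L_class_le M X Y \<or> L_class_le M Y X)"

end

theory Submission
  imports Defs "HOL-Combinatorics.Transposition"
begin

text \<open>
  If a product of generators equals \<open>(a, \<alpha>)\<close> where \<open>\<alpha>\<close> identifies only the points 1 and 2, then
  the first factor \<open>(c, \<gamma>)\<close> must identify 1 and 2 as well, so \<open>(a\<^sub>1, a\<^sub>2)\<close> is a multiple of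
  \<open>(c\<^sub>1, c\<^sub>2)\<close> under the diagonal action. Conversely, let \<open>\<epsilon>\<close> map \<open>q\<close> to \<open>p\<close> and fix all other points.
  Right multiplication of \<open>(a, \<epsilon>)\<close> can scale any coordinate \<open>j \<noteq> p, q\<close> on its own, but only the
  pair of coordinates \<open>p, q\<close> simultaneously; the initial pair is supplied by a generator of the
  diagonal action, and the scalars run through a generating set of \<open>M\<close>. An element \<open>(a, \<alpha>)\<close> with \<open>p\<alpha> = q\<alpha>\<close> is \<open>(a, \<epsilon>)(1, \<alpha>)\<close>. If \<open>M/L\<close> is a chain,
  then the initial pair can be chosen as \<open>(1, m)\<close> or \<open>(m, 1)\<close>, and all the factors can be chosen
  idempotent, using Howie's theorem that \<open>Sing\<^sub>n\<close> is idempotent-generated.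
  For the ranks, an infinite set has the same cardinality as the semigroup it generates.
\<close>

declare One_nat_def [simp del]

section \<open>Generated subsemigroups\<close>

lemma sgp_span_subset:
  assumes "A \<subseteq> S" and "\<And>x y. x \<in> S \<Longrightarrow> y \<in> S \<Longrightarrow> f x y \<in> S"
  shows "sgp_span f A \<subseteq> S"
proof
  fix x assume "x \<in> sgp_span f A"
  then show "x \<in> S" by induction (use assms in auto)
qed

section \<open>Cardinality of generating sets\<close>

lemma card_of_Times_le_infinite:
  "infinite C \<Longrightarrow> |A| \<le>o |C| \<Longrightarrow> |B| \<le>o |C| \<Longrightarrow> |A \<times> B| \<le>o |C|"
  using card_of_Times_ordLeq_infinite_Field[OF _ _ _ card_of_Card_order[of C]]
  by (simp add: Field_card_of)

lemma card_of_Un_le_infinite: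
  "infinite C \<Longrightarrow> |A| \<le>o |C| \<Longrightarrow> |B| \<le>o |C| \<Longrightarrow> |A \<union> B| \<le>o |C|"
  using card_of_Un_ordLeq_infinite_Field[OF _ _ _ card_of_Card_order[of C]]
  by (simp add: Field_card_of)

lemma card_of_finite_le_infinite:
  assumes "finite A" "infinite C"
  shows "|A| \<le>o |C|"
  using finite_ordLess_infinite[OF card_of_Well_order card_of_Well_order, of A C] assms
  by (simp add: Field_card_of ordLess_imp_ordLeq)

text \<open>Close \<open>A\<close> under products of pairs in stages \<open>B k\<close>. An infinite
  set is as large as its square, so no stage outgrows \<open>A\<close>, and neither does their
  countable union, which contains the span.\<close>

lemma card_of_sgp_span_infinite:
  assumes "infinite A"
  shows "|sgp_span f A| \<le>o |A|"
proof -
  define B where "B k = ((\<lambda>X. X \<union> (\<lambda>(x, y). f x y) ` (X \<times> X)) ^^ k) A" for k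
  have B_0: "B 0 = A" and B_Suc: "B (Suc k) = B k \<union> (\<lambda>(x, y). f x y) ` (B k \<times> B k)" for k
    by (simp_all add: B_def)
  have "|B k| \<le>o |A|" for k
  proof (induction k)
    case 0
    show ?case by (simp add: B_0 card_of_refl ordIso_imp_ordLeq)
  next
    case (Suc k)
    have "|B k \<times> B k| \<le>o |A|"
      using card_of_Times_le_infinite[OF assms Suc Suc] .
    then have "|(\<lambda>(x, y). f x y) ` (B k \<times> B k)| \<le>o |A|"
      using card_of_image ordLeq_transitive by blast
    then show ?case
      unfolding B_Suc using card_of_Un_le_infinite[OF assms Suc] by blast
  qed
  moreover have "|UNIV :: nat set| \<le>o |A|"
    using assms infinite_iff_card_of_nat by blast
  ultimately have "|\<Union>k. B k| \<le>o |A|"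
    using card_of_UNION_ordLeq_infinite[OF assms] by blast
  moreover have "sgp_span f A \<subseteq> (\<Union>k. B k)"
  proof (rule sgp_span_subset)
    show "A \<subseteq> (\<Union>k. B k)" using B_0 by blast
    have mono: "B i \<subseteq> B j" if "i \<le> j" for i j
      using that by (rule lift_Suc_mono_le[rotated]) (auto simp: B_Suc)
    fix x y assume "x \<in> (\<Union>k. B k)" "y \<in> (\<Union>k. B k)"
    then obtain i j where "x \<in> B i" "y \<in> B j" by blast
    then have "x \<in> B (max i j)" "y \<in> B (max i j)"
      using mono[of i "max i j"] mono[of j "max i j"] by auto
    then have "f x y \<in> B (Suc (max i j))" by (auto simp: B_Suc)
    then show "f x y \<in> (\<Union>k. B k)" by blast
  qed
  ultimately show ?thesis
    using card_of_mono1 ordLeq_transitive by blast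
qed

text \<open>A generating set cannot be finite here, so it is as large as its span \<open>S\<close>.
  The rank and the idempotent rank can therefore be read off whichever generating set
  \<open>least_card\<close> selects.\<close>

lemma sgp_generates_card_infinite:
  assumes "sgp_generates S f A" and "\<not> sgp_fin_gen S f"
  shows "|A| =o |S|"
proof -
  have "infinite A" using assms by (auto simp: sgp_fin_gen_def)
  then have "|S| \<le>o |A|"
    using card_of_sgp_span_infinite assms(1) unfolding sgp_generates_def by metis
  moreover have "|A| \<le>o |S|" using assms(1) by (simp add: sgp_generates_def card_of_mono1)
  ultimately show ?thesis using ordIso_iff_ordLeq by blast
qed

lemma sgp_rank_not_fin_gen:
  assumes "sgp_generates S f A" and "\<not> sgp_fin_gen S f"
  shows "sgp_rank S f =o |S|"
proof -
  have "{A. sgp_generates S f A} \<noteq> {}" using assms(1) by blast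
  from least_card[OF this] obtain B where "sgp_generates S f B" "sgp_rank S f = |B|"
    unfolding sgp_rank_def by blast
  then show ?thesis using sgp_generates_card_infinite assms(2) by metis
qed

lemma sgp_idrank_not_fin_gen:
  assumes "idempotent_generated S f" and "\<not> sgp_fin_gen S f"
  shows "sgp_idrank S f =o |S|"
proof -
  have "{A. A \<subseteq> idempotents S f \<and> sgp_generates S f A} \<noteq> {}"
    using assms(1) by (auto simp: idempotent_generated_def)
  from least_card[OF this] obtain B where "sgp_generates S f B" "sgp_idrank S f = |B|"
    unfolding sgp_idrank_def by blast
  then show ?thesis using sgp_generates_card_infinite assms(2) by metis
qed

lemma card_of_PiE_infinite:
  assumes "finite I" "infinite C"
  shows "|I \<rightarrow>\<^sub>E C| \<le>o |C|"
  using assms(1)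
proof induction
  case empty
  show ?case using assms(2) by (intro card_of_finite_le_infinite) simp_all
next
  case (insert i I)
  have "|C \<times> (I \<rightarrow>\<^sub>E C)| \<le>o |C|"
    using assms(2) card_of_mono1[OF subset_refl] insert.IH by (rule card_of_Times_le_infinite)
  then show ?case
    unfolding PiE_insert_eq using card_of_image ordLeq_transitive by blast
qed


section \<open>Singular transformations\<close>

text \<open>For distinct \<open>p\<close> and \<open>q\<close> in \<open>{1..n}\<close> these are
  exactly the idempotents of rank n - 1. The point that is moved comes first, its target
  second.\<close>

definition collapse :: "nat \<Rightarrow> nat \<Rightarrow> nat \<Rightarrow> nat \<Rightarrow> nat" where
  "collapse n q p = (\<lambda>i\<in>{1..n}. if i = q then p else i)"

lemma collapse_apply: "i \<in> {1..n} \<Longrightarrow> collapse n q p i = (if i = q then p else i)"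
  by (simp add: collapse_def)

lemma compose_outside: "i \<notin> A \<Longrightarrow> compose A g f i = undefined"
  by (simp add: compose_def)

text \<open>An injective self-map of a finite set is bijective. This form provides two points
  \<open>p\<close>, \<open>q\<close> with the same image.\<close>

lemma Sing_iff_inj: "\<alpha> \<in> Sing n \<longleftrightarrow> \<alpha> \<in> {1..n} \<rightarrow>\<^sub>E {1..n} \<and> \<not> inj_on \<alpha> {1..n}"
proof -
  have "bij_betw \<alpha> {1..n} {1..n} \<longleftrightarrow> inj_on \<alpha> {1..n}" if "\<alpha> \<in> {1..n} \<rightarrow>\<^sub>E {1..n}"
  proof -
    have "\<alpha> ` {1..n} \<subseteq> {1..n}" using that by (auto dest: PiE_mem)
    then show ?thesis by (auto simp: bij_betw_def endo_inj_surj)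
  qed
  then show ?thesis by (auto simp: Sing_def Trans_def)
qed

text \<open>Injectivity and surjectivity agree on a finite set. This form provides a point outside
  the image.\<close>

lemma Sing_iff_surj: "\<alpha> \<in> Sing n \<longleftrightarrow> \<alpha> \<in> {1..n} \<rightarrow>\<^sub>E {1..n} \<and> \<alpha> ` {1..n} \<noteq> {1..n}"
proof -
  have "inj_on \<alpha> {1..n} \<longleftrightarrow> \<alpha> ` {1..n} = {1..n}" if "\<alpha> \<in> {1..n} \<rightarrow>\<^sub>E {1..n}"
  proof -
    have "\<alpha> ` {1..n} \<subseteq> {1..n}" using that by (auto dest: PiE_mem)
    then show ?thesis by (metis endo_inj_surj finite_atLeastAtMost finite_surj_inj order_refl)
  qed
  then show ?thesis unfolding Sing_iff_inj by blast
qed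

lemma Sing_mapsto: "\<alpha> \<in> Sing n \<Longrightarrow> i \<in> {1..n} \<Longrightarrow> \<alpha> i \<in> {1..n}"
  by (auto simp: Sing_iff_inj dest: PiE_mem)

lemma collapse_in_Sing:
  assumes "p \<in> {1..n}" "q \<in> {1..n}" "p \<noteq> q"
  shows "collapse n q p \<in> Sing n"
proof -
  have "collapse n q p p = collapse n q p q"
    using assms by (simp add: collapse_apply)
  then have "\<not> inj_on (collapse n q p) {1..n}"
    using assms by (metis inj_onD)
  then show ?thesis using assms by (auto simp: Sing_iff_inj collapse_def)
qed

text \<open>Two points merged by \<alpha> remain merged, even if the second factor is a
  permutation.\<close>

lemma compose_Sing:
  assumes "\<alpha> \<in> Sing n" "\<beta> \<in> {1..n} \<rightarrow>\<^sub>E {1..n}"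
  shows "compose {1..n} \<beta> \<alpha> \<in> Sing n"
proof -
  obtain p q where "p \<in> {1..n}" "q \<in> {1..n}" "p \<noteq> q" "\<alpha> p = \<alpha> q"
    using assms(1) by (auto simp: Sing_iff_inj inj_on_def)
  then have "\<not> inj_on (compose {1..n} \<beta> \<alpha>) {1..n}"
    by (metis compose_eq inj_onD)
  then show ?thesis
    using assms by (auto simp: Sing_iff_inj compose_def intro!: PiE_mem[OF assms(2)] Sing_mapsto[OF assms(1)])
qed

text \<open>Moving \<open>q\<close> to \<open>p\<close> beforehand changes nothing if \<alpha> does
  not distinguish them. Every singular map thus has a collapse as its first factor.\<close>

lemma compose_collapse:
  assumes "\<alpha> \<in> {1..n} \<rightarrow>\<^sub>E {1..n}" "p \<in> {1..n}" "\<alpha> p = \<alpha> q"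
  shows "compose {1..n} \<alpha> (collapse n q p) = \<alpha>"
proof
  fix i show "compose {1..n} \<alpha> (collapse n q p) i = \<alpha> i"
  proof (cases "i \<in> {1..n}")
    case True
    then show ?thesis using assms(3) by (simp add: compose_eq collapse_apply)
  next
    case False
    then show ?thesis using PiE_arb[OF assms(1) False] by (simp only: compose_outside not_False_eq_True)
  qed
qed

lemma finite_Sing: "finite (Sing n)"
proof (rule finite_subset)
  show "Sing n \<subseteq> {1..n} \<rightarrow>\<^sub>E {1..n}" by (simp add: Sing_iff_inj subset_iff)
qed (simp add: finite_PiE)

section \<open>Howie's theorem\<close>

text \<open>
  The unused point \<open>h\<close> serves as temporary storage: a transposition \<open>(j k)\<close> acts on the image of
  \<open>\<beta>\<close> as the product of the collapses \<open>j \<mapsto> h\<close>, \<open>k \<mapsto> j\<close>, \<open>h \<mapsto> k\<close>.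
\<close>
lemma compose_transpose_closed:
  assumes closed: "\<And>\<beta> p q. \<beta> \<in> S \<Longrightarrow> p \<in> {1..n} \<Longrightarrow> q \<in> {1..n} \<Longrightarrow> p \<noteq> q \<Longrightarrow>
      compose {1..n} (collapse n q p) \<beta> \<in> S"
    and \<beta>: "\<beta> \<in> S" "\<beta> \<in> Sing n" and jk: "j \<in> {1..n}" "k \<in> {1..n}" "j \<noteq> k"
  shows "compose {1..n} (transpose j k) \<beta> \<in> S"
proof -
  have im: "\<beta> i \<in> {1..n}" if "i \<in> {1..n}" for i
    using Sing_mapsto[OF \<beta>(2) that] .
  have "\<beta> ` {1..n} \<subset> {1..n}"
    using \<beta>(2) im by (auto simp: Sing_iff_surj)
  then obtain h where h: "h \<in> {1..n}" "h \<notin> \<beta> ` {1..n}" by blast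
  consider "h = j" | "h = k" | "h \<noteq> j" "h \<noteq> k" by blast
  then show ?thesis
  proof cases
    case 1
    have "compose {1..n} (transpose j k) \<beta> = compose {1..n} (collapse n k j) \<beta>"
      using im h 1 by (auto simp: fun_eq_iff compose_def collapse_def transpose_def)
    then show ?thesis using closed[OF \<beta>(1)] jk by simp
  next
    case 2
    have "compose {1..n} (transpose j k) \<beta> = compose {1..n} (collapse n j k) \<beta>"
      using im h 2 by (auto simp: fun_eq_iff compose_def collapse_def transpose_def)
    then show ?thesis using closed[OF \<beta>(1)] jk by simp
  next
    case 3
    have "compose {1..n} (transpose j k) \<beta> i = compose {1..n} (collapse n h k)
        (compose {1..n} (collapse n k j) (compose {1..n} (collapse n j h) \<beta>)) i" for i
    proof (cases "i \<in> {1..n}")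
      case True
      then have "\<beta> i \<in> {1..n}" "\<beta> i \<noteq> h" using im h by auto
      then show ?thesis
        using True h(1) jk 3 by (auto simp: compose_eq collapse_apply transpose_def)
    qed (simp only: compose_outside not_False_eq_True)
    then have "compose {1..n} (transpose j k) \<beta> = compose {1..n} (collapse n h k)
        (compose {1..n} (collapse n k j) (compose {1..n} (collapse n j h) \<beta>))" ..
    then show ?thesis using closed \<beta>(1) jk h(1) 3 by simp
  qed
qed

lemma compose_Sing_closed:
  assumes closed: "\<And>\<beta> p q. \<beta> \<in> S \<Longrightarrow> p \<in> {1..n} \<Longrightarrow> q \<in> {1..n} \<Longrightarrow> p \<noteq> q \<Longrightarrow>
      compose {1..n} (collapse n q p) \<beta> \<in> S"
    and "\<beta> \<in> S" "S \<subseteq> Sing n" "\<gamma> \<in> {1..n} \<rightarrow>\<^sub>E {1..n}"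
  shows "compose {1..n} \<gamma> \<beta> \<in> S"
  using assms(2,4)
proof (induction "card {i \<in> {1..n}. \<gamma> i \<noteq> i}" arbitrary: \<beta> \<gamma> rule: less_induct)
  case less
  note \<beta> = less.prems(1) and \<gamma> = less.prems(2)
  have im: "\<beta> i \<in> {1..n}" if "i \<in> {1..n}" for i
    using Sing_mapsto \<beta> assms(3) that by blast
  have im': "\<gamma> i \<in> {1..n}" if "i \<in> {1..n}" for i
    using PiE_mem[OF \<gamma>] that .
  show ?case
  proof (cases "\<exists>j\<in>{1..n}. \<gamma> j \<noteq> j")
    case False
    have "compose {1..n} \<gamma> \<beta> i = \<beta> i" for i
    proof (cases "i \<in> {1..n}")
      case True
      then show ?thesis using False im[OF True] by (metis compose_eq)
    next
      case False
      then show ?thesis using \<beta> assms(3) PiE_arb[of \<beta> "{1..n}" "\<lambda>_. {1..n}" i]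
        unfolding compose_def restrict_def by (auto simp: Sing_iff_inj)
    qed
    then have "compose {1..n} \<gamma> \<beta> = \<beta>" by blast
    then show ?thesis using \<beta> by simp
  next
    case True
    then obtain j where j: "j \<in> {1..n}" "\<gamma> j \<noteq> j" by blast
    show ?thesis
    proof (cases "\<gamma> (\<gamma> j) = \<gamma> j")
      case True
      \<comment> \<open>Here \<open>\<gamma> j\<close> is fixed by \<gamma>, so a collapse can send
        \<open>j\<close> there first, and \<open>\<gamma>'\<close> may fix \<open>j\<close>.\<close>
      define \<gamma>' where "\<gamma>' = \<gamma>(j := j)"
      have "{i \<in> {1..n}. \<gamma>' i \<noteq> i} \<subset> {i \<in> {1..n}. \<gamma> i \<noteq> i}"
        using j by (auto simp: \<gamma>'_def)
      then have "card {i \<in> {1..n}. \<gamma>' i \<noteq> i} < card {i \<in> {1..n}. \<gamma> i \<noteq> i}"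
        by (intro psubset_card_mono) auto
      moreover have "\<gamma>' \<in> {1..n} \<rightarrow>\<^sub>E {1..n}"
        unfolding \<gamma>'_def using \<gamma> j(1) by (auto simp: PiE_iff extensional_def)
      moreover have "compose {1..n} (collapse n j (\<gamma> j)) \<beta> \<in> S"
        using closed[OF \<beta> im'[OF j(1)] j(1) j(2)] .
      ultimately have "compose {1..n} \<gamma>' (compose {1..n} (collapse n j (\<gamma> j)) \<beta>) \<in> S"
        using less.hyps by blast
      moreover have "compose {1..n} \<gamma>' (compose {1..n} (collapse n j (\<gamma> j)) \<beta>) = compose {1..n} \<gamma> \<beta>"
      proof
        fix i show "compose {1..n} \<gamma>' (compose {1..n} (collapse n j (\<gamma> j)) \<beta>) i = compose {1..n} \<gamma> \<beta> i"
        proof (cases "i \<in> {1..n}")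
          case i: True
          show ?thesis
            using True j im[OF i] i by (simp add: compose_eq collapse_apply \<gamma>'_def)
        qed (simp only: compose_outside not_False_eq_True)
      qed
      ultimately show ?thesis by simp
    next
      case False
      \<comment> \<open>Swapping \<open>j\<close> and \<open>\<gamma> j\<close> after \<gamma> makes
        \<open>j\<close> fixed and loses no fixed point, since \<gamma> fixes neither of the two.
        Swapping once more recovers \<gamma>.\<close>
      define \<gamma>' where "\<gamma>' = compose {1..n} (transpose j (\<gamma> j)) \<gamma>"
      have "{i \<in> {1..n}. \<gamma>' i \<noteq> i} \<subset> {i \<in> {1..n}. \<gamma> i \<noteq> i}"
      proof
        show "{i \<in> {1..n}. \<gamma>' i \<noteq> i} \<subseteq> {i \<in> {1..n}. \<gamma> i \<noteq> i}"
        proof (intro subsetI CollectI conjI)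
          fix i assume i: "i \<in> {i \<in> {1..n}. \<gamma>' i \<noteq> i}"
          then show i': "i \<in> {1..n}" by blast
          show "\<gamma> i \<noteq> i"
          proof
            assume "\<gamma> i = i"
            then have "i \<noteq> j" "i \<noteq> \<gamma> j" using j(2) False by metis+
            then have "\<gamma>' i = i"
              using \<open>\<gamma> i = i\<close> by (simp add: \<gamma>'_def compose_eq[OF i'])
            then show False using i by blast
          qed
        qed
        show "{i \<in> {1..n}. \<gamma>' i \<noteq> i} \<noteq> {i \<in> {1..n}. \<gamma> i \<noteq> i}"
        proof -
          have "\<gamma>' j = j" using j(1) by (simp add: \<gamma>'_def compose_eq)
          then show ?thesis using j by blast
        qed
      qed
      then have "card {i \<in> {1..n}. \<gamma>' i \<noteq> i} < card {i \<in> {1..n}. \<gamma> i \<noteq> i}"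
        by (intro psubset_card_mono) auto
      moreover have \<gamma>': "\<gamma>' \<in> {1..n} \<rightarrow>\<^sub>E {1..n}"
        unfolding \<gamma>'_def compose_def restrict_PiE_iff transpose_def
        using im' j(1) by simp
      ultimately have \<beta>': "compose {1..n} \<gamma>' \<beta> \<in> S"
        using less.hyps \<beta> by blast
      have "compose {1..n} (transpose j (\<gamma> j)) (compose {1..n} \<gamma>' \<beta>) \<in> S"
        by (rule compose_transpose_closed[OF closed \<beta>' subsetD[OF assms(3) \<beta>'] j(1) im'[OF j(1)]
              j(2)[symmetric]])
      moreover have "compose {1..n} (transpose j (\<gamma> j)) (compose {1..n} \<gamma>' \<beta>) = compose {1..n} \<gamma> \<beta>"
      proof
        fix i show "compose {1..n} (transpose j (\<gamma> j)) (compose {1..n} \<gamma>' \<beta>) i = compose {1..n} \<gamma> \<beta> i"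
        proof (cases "i \<in> {1..n}")
          case True
          then show ?thesis using im[OF True] by (simp add: compose_eq \<gamma>'_def)
        qed (simp only: compose_outside not_False_eq_True)
      qed
      ultimately show ?thesis by simp
    qed
  qed
qed

text \<open>A singular \<alpha> equals a collapse followed by \<alpha>. The collapse lies in
  \<open>S\<close>, and by \<open>compose_Sing_closed\<close> any map may be applied after an
  element of \<open>S\<close>.\<close>

lemma Howie_collapse_generate_Sing:
  assumes "\<And>p q. p \<in> {1..n} \<Longrightarrow> q \<in> {1..n} \<Longrightarrow> p \<noteq> q \<Longrightarrow> collapse n q p \<in> S"
    and "\<And>\<alpha> \<beta>. \<alpha> \<in> S \<Longrightarrow> \<beta> \<in> S \<Longrightarrow> compose {1..n} \<beta> \<alpha> \<in> S" and "S \<subseteq> Sing n"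
  shows "S = Sing n"
proof
  show "Sing n \<subseteq> S"
  proof
    fix \<alpha> assume \<alpha>: "\<alpha> \<in> Sing n"
    then obtain p q where pq: "p \<in> {1..n}" "q \<in> {1..n}" "p \<noteq> q" "\<alpha> p = \<alpha> q"
      by (auto simp: Sing_iff_inj inj_on_def)
    have "compose {1..n} \<gamma> \<beta> \<in> S" if "\<beta> \<in> S" "\<gamma> \<in> {1..n} \<rightarrow>\<^sub>E {1..n}" for \<beta> \<gamma>
      using assms(2)[OF _ assms(1)] that(1) assms(3) that(2) by (rule compose_Sing_closed)
    then have "compose {1..n} \<alpha> (collapse n q p) \<in> S"
      using \<alpha> assms(1)[OF pq(1-3)] by (simp only: Sing_iff_inj)
    then show "\<alpha> \<in> S"
      using \<alpha> pq by (simp add: compose_collapse Sing_iff_inj)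
  qed
qed (rule assms(3))


section \<open>Generating the wreath product\<close>

lemma fst_wr_Sing:
  assumes "x \<in> wr_Sing M n" "i \<in> {1..n}"
  shows "fst x i \<in> carrier M"
  using assms PiE_mem[of "fst x" "{1..n}" "\<lambda>_. carrier M" i] by (simp add: wr_Sing_def mem_Times_iff)

section \<open>Cardinality of the wreath product\<close>

text \<open>Distinct \<open>a\<close> give distinct elements, hence the lower bound on the
  cardinality. These elements also realize every member of \<open>M\<close> as an entry.\<close>

lemma wr_Sing_nonempty:
  assumes "n \<ge> 2" "a \<in> carrier M"
  shows "(\<lambda>i\<in>{1..n}. a, collapse n 2 1) \<in> wr_Sing M n"
  using assms collapse_in_Sing[of 1 n 2] by (simp add: wr_Sing_def)

lemma card_of_wr_Sing:
  assumes "n \<ge> 2" and inf: "infinite (carrier M)"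
  shows "|wr_Sing M n| =o |carrier M|"
proof -
  have "|Sing n| \<le>o |carrier M|"
    using finite_Sing inf by (rule card_of_finite_le_infinite)
  then have "|wr_Sing M n| \<le>o |carrier M|"
    unfolding wr_Sing_def by (simp add: card_of_Times_le_infinite inf card_of_PiE_infinite)
  moreover have "|carrier M| \<le>o |wr_Sing M n|"
  proof (rule card_of_ordLeqI)
    show "(\<lambda>i\<in>{1..n}. a, collapse n 2 1) \<in> wr_Sing M n" if "a \<in> carrier M" for a
      using wr_Sing_nonempty assms(1) that .
    show "inj_on (\<lambda>a. (\<lambda>i\<in>{1..n}. a, collapse n 2 1)) (carrier M)"
    proof (rule inj_onI)
      fix a b assume "(\<lambda>i\<in>{1..n}. a, collapse n 2 1) = (\<lambda>i\<in>{1..n}. b, collapse n 2 1)"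
      then have "(\<lambda>i\<in>{1..n}. a) 1 = (\<lambda>i\<in>{1..n}. b) 1" by simp
      then show "a = b" using assms(1) by simp
    qed
  qed
  ultimately show ?thesis using ordIso_iff_ordLeq by blast
qed

lemma wr_Sing_finite_fin_gen:
  assumes "monoid M" "finite (carrier M)"
  shows "sgp_fin_gen (wr_Sing M n) (wr_mult M n)"
proof -
  have "finite (wr_Sing M n)"
    using assms(2) finite_Sing by (simp add: wr_Sing_def finite_PiE)
  moreover have "sgp_generates (wr_Sing M n) (wr_mult M n) (wr_Sing M n)"
    using sgp_span_subset[of "wr_Sing M n" "wr_Sing M n" "wr_mult M n"] wr_mult_closed[OF assms(1)]
    by (auto simp: sgp_generates_def intro: sgp_span.incl)
  ultimately show ?thesis by (auto simp: sgp_fin_gen_def)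
qed

context monoid
begin

section \<open>Necessity of the two finiteness conditions\<close>

text \<open>Here \<open>g\<close> is the first generator in a product with value \<open>x\<close>.
  Points merged by \<open>g\<close> follow the same path afterwards, so their entries receive the
  same right factor \<open>d\<close>.\<close>

lemma sgp_span_wr_mult_first:
  assumes "A \<subseteq> wr_Sing G n" "x \<in> sgp_span (wr_mult G n) A"
  shows "\<exists>g\<in>A. \<forall>i\<in>{1..n}. \<forall>j\<in>{1..n}. snd g i = snd g j \<longrightarrow>
      snd x i = snd x j \<and> (\<exists>d\<in>carrier G. fst x i = fst g i \<otimes> d \<and> fst x j = fst g j \<otimes> d)"
  using assms(2)
proof induction
  case (incl x)
  then have "fst x i \<in> carrier G" if "i \<in> {1..n}" for i
    using assms(1) that fst_wr_Sing by blast
  then show ?case using incl by (intro bexI[of _ x]) (auto intro!: bexI[of _ \<one>])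
next
  case (prod x y)
  have sub: "sgp_span (wr_mult G n) A \<subseteq> wr_Sing G n"
    using assms(1) wr_mult_closed[OF monoid_axioms] by (rule sgp_span_subset)
  obtain a \<alpha> b \<beta> where xy: "x = (a, \<alpha>)" "y = (b, \<beta>)" by (meson surj_pair)
  obtain g where g: "g \<in> A" "\<And>i j. i \<in> {1..n} \<Longrightarrow> j \<in> {1..n} \<Longrightarrow> snd g i = snd g j \<Longrightarrow>
      \<alpha> i = \<alpha> j \<and> (\<exists>d\<in>carrier G. a i = fst g i \<otimes> d \<and> a j = fst g j \<otimes> d)"
    using prod.IH(1) unfolding xy fst_conv snd_conv by blast
  have gc: "fst g i \<in> carrier G" if "i \<in> {1..n}" for i
    using g(1) assms(1) that fst_wr_Sing by blast
  have "(a, \<alpha>) \<in> wr_Sing G n" "(b, \<beta>) \<in> wr_Sing G n"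
    using prod.hyps sub xy by blast+
  then have ba: "b (\<alpha> i) \<in> carrier G" if "i \<in> {1..n}" for i
    using that Sing_mapsto[of \<alpha> n i] PiE_mem[of b "{1..n}" "\<lambda>_. carrier G" "\<alpha> i"]
    by (simp add: wr_Sing_def)
  show ?case
  proof (intro bexI[OF _ g(1)] ballI impI conjI)
    fix i j assume ij: "i \<in> {1..n}" "j \<in> {1..n}" "snd g i = snd g j"
    from g(2)[OF ij] obtain d where d: "\<alpha> i = \<alpha> j" "d \<in> carrier G"
        "a i = fst g i \<otimes> d" "a j = fst g j \<otimes> d" by blast
    show "snd (wr_mult G n x y) i = snd (wr_mult G n x y) j"
      using ij d by (simp add: xy wr_mult_def compose_def)
    \<comment> \<open>The new factor \<open>b (\<alpha> i)\<close> is shared because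
      \<open>\<alpha> i = \<alpha> j\<close>.\<close>
    show "\<exists>d\<in>carrier G. fst (wr_mult G n x y) i = fst g i \<otimes> d \<and> fst (wr_mult G n x y) j = fst g j \<otimes> d"
      using ij d gc ba by (intro bexI[of _ "d \<otimes> b (\<alpha> i)"]) (auto simp: xy wr_mult_def m_assoc)
  qed
qed

lemma wr_Sing_fin_gen_imp_diag_act_fin_gen:
  assumes "n \<ge> 2" "sgp_fin_gen (wr_Sing G n) (wr_mult G n)"
  shows "diag_act_fin_gen G"
proof -
  obtain A where A: "finite A" "A \<subseteq> wr_Sing G n" "sgp_span (wr_mult G n) A = wr_Sing G n"
    using assms(2) by (auto simp: sgp_fin_gen_def sgp_generates_def)
  define \<Omega> where "\<Omega> = (\<lambda>g. (fst g 1, fst g 2)) ` A"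
  have \<Omega>: "finite \<Omega>" "\<Omega> \<subseteq> carrier G \<times> carrier G"
    using A(1,2) assms(1) fst_wr_Sing by (fastforce simp: \<Omega>_def)+
  moreover have "\<exists>w\<in>\<Omega>. \<exists>c\<in>carrier G. (x, y) = diag_act G w c"
    if xy: "x \<in> carrier G" "y \<in> carrier G" for x y
  proof -
    \<comment> \<open>The given pair is placed at the only two points that
      \<open>collapse n 2 1\<close> merges.\<close>
    have "(\<lambda>i\<in>{1..n}. if i = 1 then x else y, collapse n 2 1) \<in> wr_Sing G n" (is "?z \<in> _")
      using xy assms(1) collapse_in_Sing[of 1 n 2] by (auto simp: wr_Sing_def)
    then have "?z \<in> sgp_span (wr_mult G n) A" using A(3) by (rule ssubst[rotated])
    from sgp_span_wr_mult_first[OF A(2) this]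
    obtain g where g: "g \<in> A" and g_eq: "\<forall>i\<in>{1..n}. \<forall>j\<in>{1..n}. snd g i = snd g j \<longrightarrow>
      snd ?z i = snd ?z j \<and> (\<exists>d\<in>carrier G. fst ?z i = fst g i \<otimes> d \<and> fst ?z j = fst g j \<otimes> d)"
      by (rule bexE)
    have "snd g \<in> Sing n" using g A(2) by (auto simp: wr_Sing_def)
    then obtain i j where ij: "i \<in> {1..n}" "j \<in> {1..n}" "i \<noteq> j" "snd g i = snd g j"
      by (auto simp: Sing_iff_inj inj_on_def)
    then have "snd ?z i = snd ?z j" using g_eq by blast
    then have "i = 1 \<and> j = 2 \<or> i = 2 \<and> j = 1"
      using ij by (auto simp: collapse_def split: if_splits)
    then have "snd g 1 = snd g 2" using ij(4) by auto
    then obtain d where "d \<in> carrier G" "fst ?z 1 = fst g 1 \<otimes> d" "fst ?z 2 = fst g 2 \<otimes> d"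
      using bspec[OF bspec[OF g_eq, of 1], of 2] assms(1) by auto
    then show ?thesis using g assms(1) by (auto simp: \<Omega>_def diag_act_def)
  qed
  then have "carrier G \<times> carrier G \<subseteq> {diag_act G p c | p c. p \<in> \<Omega> \<and> c \<in> carrier G}"
    by blast
  moreover have "{diag_act G p c | p c. p \<in> \<Omega> \<and> c \<in> carrier G} \<subseteq> carrier G \<times> carrier G"
    using \<Omega>(2) by (auto simp: diag_act_def)
  ultimately show ?thesis unfolding diag_act_fin_gen_def by blast
qed

text \<open>Each entry of a product is a product of entries of its factors, so the finitely many
  entries of the generators generate \<open>M\<close>.\<close>

lemma wr_Sing_fin_gen_imp_fin_gen:
  assumes "n \<ge> 2" "sgp_fin_gen (wr_Sing G n) (wr_mult G n)"
  shows "sgp_fin_gen (carrier G) (mult G)"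
proof -
  obtain A where A: "finite A" "A \<subseteq> wr_Sing G n" "sgp_span (wr_mult G n) A = wr_Sing G n"
    using assms(2) by (auto simp: sgp_fin_gen_def sgp_generates_def)
  define X where "X = (\<lambda>(g, i). fst g i) ` (A \<times> {1..n})"
  have X: "finite X" "X \<subseteq> carrier G"
    using A(1,2) fst_wr_Sing by (fastforce simp: X_def)+
  have "\<forall>i\<in>{1..n}. fst x i \<in> sgp_span (mult G) X" if "x \<in> sgp_span (wr_mult G n) A" for x
    using that
  proof induction
    case (incl x)
    then show ?case by (auto simp: X_def intro!: sgp_span.incl image_eqI[of _ _ "(x, _)"])
  next
    case (prod x y)
    then have "x \<in> wr_Sing G n" using A(3) by blast
    then have "snd x i \<in> {1..n}" if "i \<in> {1..n}" for i
      using that Sing_mapsto by (auto simp: wr_Sing_def)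
    then show ?case
      using prod.IH by (auto simp: wr_mult_def case_prod_unfold intro!: sgp_span.prod)
  qed
  then have "a \<in> sgp_span (mult G) X" if "a \<in> carrier G" for a
    using wr_Sing_nonempty[OF assms(1) that] A(3) assms(1) by (fastforce dest!: bspec[of _ _ 1])
  moreover have "sgp_span (mult G) X \<subseteq> carrier G"
    using X(2) by (rule sgp_span_subset) auto
  ultimately show ?thesis
    using X by (auto simp: sgp_fin_gen_def sgp_generates_def)
qed

section \<open>Building elements coordinate by coordinate, and sufficiency\<close>

text \<open>The pair at \<open>p\<close>, \<open>q\<close> is adjusted first, then the other
  coordinates one by one. Scaling is a hypothesis because it is obtained in two ways: from
  generators of \<open>M\<close>, and from idempotents. The restriction \<open>j \<noteq> q\<close>
  fits the latter, where \<open>q\<close> serves as free storage.\<close>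

lemma collapse_span:
  assumes S: "\<And>j m a. (a, collapse n q p) \<in> S \<Longrightarrow> j \<in> {1..n} \<Longrightarrow> j \<noteq> q \<Longrightarrow> m \<in> carrier G \<Longrightarrow>
        a \<in> {1..n} \<rightarrow>\<^sub>E carrier G \<Longrightarrow>
        (\<lambda>i\<in>{1..n}. if collapse n q p i = j then a i \<otimes> m else a i, collapse n q p) \<in> S"
    and pq: "p \<in> {1..n}" "q \<in> {1..n}" "p \<noteq> q"
    and a: "a \<in> {1..n} \<rightarrow>\<^sub>E carrier G"
    and c: "u \<in> carrier G" "v \<in> carrier G" "c \<in> carrier G" "a p = u \<otimes> c" "a q = v \<otimes> c"
    and start: "(\<lambda>i\<in>{1..n}. if i = p then u else if i = q then v else \<one>, collapse n q p) \<in> S"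
  shows "(a, collapse n q p) \<in> S"
proof -
  have ac: "a i \<in> carrier G" if "i \<in> {1..n}" for i using PiE_mem[OF a that] .
  have "(\<lambda>i\<in>{1..n}. if i \<in> J \<union> {p, q} then a i else \<one>, collapse n q p) \<in> S"
    if "finite J" "J \<subseteq> {1..n} - {p, q}" for J
    using that
  proof induction
    case empty
    \<comment> \<open>Both \<open>p\<close> and \<open>q\<close> are sent to \<open>p\<close>, so
      scaling there by \<open>c\<close> turns \<open>(u, v)\<close> into
      \<open>(a p, a q)\<close>.\<close>
    have "(\<lambda>i\<in>{1..n}. if collapse n q p i = p
        then (\<lambda>i\<in>{1..n}. if i = p then u else if i = q then v else \<one>) i \<otimes> c
        else (\<lambda>i\<in>{1..n}. if i = p then u else if i = q then v else \<one>) i, collapse n q p) \<in> S"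
      using c by (intro S[OF start] pq) auto
    also have "(\<lambda>i\<in>{1..n}. if collapse n q p i = p
        then (\<lambda>i\<in>{1..n}. if i = p then u else if i = q then v else \<one>) i \<otimes> c
        else (\<lambda>i\<in>{1..n}. if i = p then u else if i = q then v else \<one>) i)
      = (\<lambda>i\<in>{1..n}. if i \<in> {} \<union> {p, q} then a i else \<one>)"
      using pq c by (auto simp: collapse_def fun_eq_iff restrict_def)
    finally show ?case .
  next
    case (insert k J)
    \<comment> \<open>Only \<open>k\<close> is sent to \<open>k\<close>, so this replaces the single
      entry \<one> by \<open>a k\<close>.\<close>
    have "(\<lambda>i\<in>{1..n}. if collapse n q p i = k
        then (\<lambda>i\<in>{1..n}. if i \<in> J \<union> {p, q} then a i else \<one>) i \<otimes> a k
        else (\<lambda>i\<in>{1..n}. if i \<in> J \<union> {p, q} then a i else \<one>) i, collapse n q p) \<in> S"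
      using insert ac by (intro S) auto
    also have "(\<lambda>i\<in>{1..n}. if collapse n q p i = k
        then (\<lambda>i\<in>{1..n}. if i \<in> J \<union> {p, q} then a i else \<one>) i \<otimes> a k
        else (\<lambda>i\<in>{1..n}. if i \<in> J \<union> {p, q} then a i else \<one>) i)
      = (\<lambda>i\<in>{1..n}. if i \<in> insert k J \<union> {p, q} then a i else \<one>)"
      using insert pq ac by (auto simp: collapse_def fun_eq_iff restrict_def)
    finally show ?case .
  qed
  from this[of "{1..n} - {p, q}"]
  have "(\<lambda>i\<in>{1..n}. if i \<in> {1..n} - {p, q} \<union> {p, q} then a i else \<one>, collapse n q p) \<in> S"
    by simp
  also have "(\<lambda>i\<in>{1..n}. if i \<in> {1..n} - {p, q} \<union> {p, q} then a i else \<one>) = restrict a {1..n}"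
    by (rule restrict_ext) auto
  also have "\<dots> = a"
    using a by (simp add: PiE_iff extensional_restrict)
  finally show ?thesis .
qed

text \<open>The entries \<one> leave \<open>a\<close> intact, and \<alpha> absorbs the collapse. It
  thus suffices to generate the elements over collapses and those with constant tuple
  \<one>.\<close>

lemma wr_mult_collapse:
  assumes "\<alpha> \<in> Sing n" "p \<in> {1..n}" "\<alpha> p = \<alpha> q" "a \<in> {1..n} \<rightarrow>\<^sub>E carrier G"
  shows "wr_mult G n (a, collapse n q p) (\<lambda>i\<in>{1..n}. \<one>, \<alpha>) = (a, \<alpha>)"
proof -
  have "compose {1..n} \<alpha> (collapse n q p) = \<alpha>"
    using assms by (simp add: compose_collapse Sing_iff_inj)
  moreover have "(\<lambda>i\<in>{1..n}. a i \<otimes> (\<lambda>i\<in>{1..n}. \<one>) (collapse n q p i)) i = a i" for i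
    using assms(2) PiE_mem[OF assms(4), of i] PiE_arb[OF assms(4), of i]
    by (auto simp: collapse_def)
  ultimately show ?thesis by (auto simp: wr_mult_def)
qed

lemma fin_gen_imp_wr_Sing_fin_gen:
  assumes "sgp_fin_gen (carrier G) (mult G)" "diag_act_fin_gen G"
  shows "sgp_fin_gen (wr_Sing G n) (wr_mult G n)"
proof -
  obtain X where X: "finite X" "X \<subseteq> carrier G" "sgp_span (mult G) X = carrier G"
    using assms(1) by (auto simp: sgp_fin_gen_def sgp_generates_def)
  obtain \<Omega> where \<Omega>: "finite \<Omega>" "\<Omega> \<subseteq> carrier G \<times> carrier G"
      "{diag_act G p c | p c. p \<in> \<Omega> \<and> c \<in> carrier G} = carrier G \<times> carrier G"
    using assms(2) by (auto simp: diag_act_fin_gen_def)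
  \<comment> \<open>\<open>X\<close> provides the scalars, the components of \<Omega> the initial
    pair, and \<one> the coordinates left unchanged.\<close>
  define Y where "Y = insert \<one> (X \<union> fst ` \<Omega> \<union> snd ` \<Omega>)"
  define A where "A = ({1..n} \<rightarrow>\<^sub>E Y) \<times> Sing n"
  define S where "S = sgp_span (wr_mult G n) A"
  have Y: "finite Y" "Y \<subseteq> carrier G" using X \<Omega> by (auto simp: Y_def)
  have A: "finite A" using Y finite_Sing by (auto simp: A_def intro: finite_PiE)
  have AW: "A \<subseteq> wr_Sing G n"
    unfolding A_def wr_Sing_def using Y(2) by (intro Sigma_mono PiE_mono) auto
  have scale: "(\<lambda>i\<in>{1..n}. if collapse n q p i = j then a i \<otimes> m else a i, collapse n q p) \<in> S"
    if pq: "p \<in> {1..n}" "q \<in> {1..n}" "p \<noteq> q" and j: "j \<in> {1..n}"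
      and a: "(a, collapse n q p) \<in> S" "a \<in> {1..n} \<rightarrow>\<^sub>E carrier G" and m: "m \<in> carrier G"
    for p q j a m
  proof -
    have "m \<in> sgp_span (mult G) X" using m X by simp
    then show ?thesis using a
    \<comment> \<open>Induction on \<open>m\<close> as a product over \<open>X\<close>. The tuple
      varies, since scaling by \<open>y\<close> starts from the one already scaled by
      \<open>x\<close>.\<close>
    proof (induction arbitrary: a)
      case (incl x)
      have ac: "a i \<in> carrier G" if "i \<in> {1..n}" for i using PiE_mem[OF incl(3) that] .
      have "(\<lambda>i\<in>{1..n}. if i = j then x else \<one>, collapse n q p) \<in> S"
        unfolding S_def A_def using incl(1) pq
        by (intro sgp_span.incl) (auto simp: Y_def collapse_in_Sing)
      then have "wr_mult G n (a, collapse n q p) (\<lambda>i\<in>{1..n}. if i = j then x else \<one>, collapse n q p) \<in> S"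
        using incl(2) unfolding S_def by (intro sgp_span.prod)
      moreover have "wr_mult G n (a, collapse n q p) (\<lambda>i\<in>{1..n}. if i = j then x else \<one>, collapse n q p)
        = (\<lambda>i\<in>{1..n}. if collapse n q p i = j then a i \<otimes> x else a i, collapse n q p)"
        using ac pq by (auto simp: wr_mult_def compose_def collapse_def fun_eq_iff restrict_def)
      ultimately show ?case by (simp only:)
    next
      case (prod x y)
      have ac: "a i \<in> carrier G" if "i \<in> {1..n}" for i using PiE_mem[OF prod.prems(2) that] .
      have xy: "x \<in> carrier G" "y \<in> carrier G" using prod.hyps X by auto
      let ?b = "\<lambda>i\<in>{1..n}. if collapse n q p i = j then a i \<otimes> x else a i"
      have "?b \<in> {1..n} \<rightarrow>\<^sub>E carrier G" using ac xy by auto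
      from prod.IH(2)[OF prod.IH(1)[OF prod.prems] this]
      have "(\<lambda>i\<in>{1..n}. if collapse n q p i = j then ?b i \<otimes> y else ?b i, collapse n q p) \<in> S" .
      moreover have "(\<lambda>i\<in>{1..n}. if collapse n q p i = j then ?b i \<otimes> y else ?b i)
        = (\<lambda>i\<in>{1..n}. if collapse n q p i = j then a i \<otimes> (x \<otimes> y) else a i)"
        using ac xy by (auto simp: fun_eq_iff restrict_def m_assoc)
      ultimately show ?case by (simp only:)
    qed
  qed
  have "(a, \<alpha>) \<in> S" if a: "a \<in> {1..n} \<rightarrow>\<^sub>E carrier G" and \<alpha>: "\<alpha> \<in> Sing n" for a \<alpha>
  proof -
    obtain p q where pq: "p \<in> {1..n}" "q \<in> {1..n}" "p \<noteq> q" "\<alpha> p = \<alpha> q"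
      using \<alpha> by (auto simp: Sing_iff_inj inj_on_def)
    have "(a p, a q) \<in> carrier G \<times> carrier G" using PiE_mem[OF a] pq by auto
    then have "(a p, a q) \<in> {diag_act G p c | p c. p \<in> \<Omega> \<and> c \<in> carrier G}"
      unfolding \<Omega>(3) .
    then obtain u v c where uvc: "(u, v) \<in> \<Omega>" "c \<in> carrier G" "a p = u \<otimes> c" "a q = v \<otimes> c"
      by (auto simp: diag_act_def)
    then have uvY: "u \<in> Y" "v \<in> Y" "\<one> \<in> Y" by (force simp: Y_def)+
    then have "(\<lambda>i\<in>{1..n}. if i = p then u else if i = q then v else \<one>, collapse n q p) \<in> S"
      unfolding S_def A_def using pq collapse_in_Sing by (intro sgp_span.incl) auto
    then have "(a, collapse n q p) \<in> S"
      using uvc uvY Y(2) pq by (intro collapse_span[OF _ _ _ _ a, where u=u and v=v and c=c] scale) auto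
    moreover have "(\<lambda>i\<in>{1..n}. \<one>, \<alpha>) \<in> S"
      unfolding S_def A_def using \<alpha> by (intro sgp_span.incl) (auto simp: Y_def)
    ultimately have "wr_mult G n (a, collapse n q p) (\<lambda>i\<in>{1..n}. \<one>, \<alpha>) \<in> S"
      unfolding S_def by (rule sgp_span.prod)
    then show ?thesis using \<alpha> pq a by (simp add: wr_mult_collapse)
  qed
  then have "wr_Sing G n \<subseteq> S" by (auto simp: wr_Sing_def)
  moreover have "S \<subseteq> wr_Sing G n"
    unfolding S_def using AW wr_mult_closed[OF monoid_axioms] by (rule sgp_span_subset)
  ultimately show ?thesis
    using A AW unfolding sgp_fin_gen_def sgp_generates_def S_def by blast
qed

section \<open>Idempotent generation in the chain case\<close>

text \<open>Comparable representatives a' and b' give a \<le> a' \<le> b' \<le> b or the reverse, so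
  comparability passes from classes to all their elements.\<close>

lemma L_chain_total:
  assumes "L_chain G" "a \<in> carrier G" "b \<in> carrier G"
  shows "L_le G a b \<or> L_le G b a"
proof -
  have le_trans: "L_le G x z" if "L_le G x y" "L_le G y z" "z \<in> carrier G" for x y z
    using that unfolding L_le_def by (metis m_assoc m_closed)
  have "L_rel G `` {a} \<in> carrier G // L_rel G" "L_rel G `` {b} \<in> carrier G // L_rel G"
    using assms by (auto intro: quotientI)
  then have "L_class_le G (L_rel G `` {a}) (L_rel G `` {b}) \<or> L_class_le G (L_rel G `` {b}) (L_rel G `` {a})"
    using assms(1) by (auto simp: L_chain_def)
  then show ?thesis
    using le_trans assms(2,3) unfolding L_class_le_def L_rel_def by blast
qed

text \<open>The point \<open>q\<close> is outside the image of the collapse, so squaring multiplies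
  every entry by \<one>, whatever \<open>m\<close> is.\<close>

lemma collapse_idempotent:
  assumes "p \<in> {1..n}" "q \<in> {1..n}" "p \<noteq> q" "m \<in> carrier G"
  shows "(\<lambda>i\<in>{1..n}. if i = q then m else \<one>, collapse n q p) \<in> idempotents (wr_Sing G n) (wr_mult G n)"
proof -
  have "compose {1..n} (collapse n q p) (collapse n q p) = collapse n q p"
    using assms collapse_in_Sing[OF assms(1-3)]
    by (intro compose_collapse) (auto simp: Sing_iff_inj collapse_apply)
  moreover have "(\<lambda>i\<in>{1..n}. (\<lambda>i\<in>{1..n}. if i = q then m else \<one>) i
      \<otimes> (\<lambda>i\<in>{1..n}. if i = q then m else \<one>) (collapse n q p i))
    = (\<lambda>i\<in>{1..n}. if i = q then m else \<one>)"
    using assms by (intro restrict_ext) (auto simp: collapse_apply)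
  ultimately show ?thesis
    using assms(4) collapse_in_Sing[OF assms(1-3)]
    by (simp add: idempotents_def wr_mult_def wr_Sing_def)
qed

lemma L_chain_imp_idempotent_generated:
  assumes "L_chain G"
  shows "idempotent_generated (wr_Sing G n) (wr_mult G n)"
proof -
  let ?E = "idempotents (wr_Sing G n) (wr_mult G n)"
  define S where "S = sgp_span (wr_mult G n) ?E"
  have S_mult: "wr_mult G n x y \<in> S" if "x \<in> S" "y \<in> S" for x y
    using that unfolding S_def by (rule sgp_span.prod)
  have E: "(\<lambda>i\<in>{1..n}. if i = q then m else \<one>, collapse n q p) \<in> S"
    if "p \<in> {1..n}" "q \<in> {1..n}" "p \<noteq> q" "m \<in> carrier G" for p q m
    unfolding S_def using collapse_idempotent[OF that] by (rule sgp_span.incl)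
  have E1: "(\<lambda>i\<in>{1..n}. \<one>, collapse n q p) \<in> S"
    if "p \<in> {1..n}" "q \<in> {1..n}" "p \<noteq> q" for p q
    using E[OF that, of \<one>] by simp
  \<comment> \<open>Elements with constant tuple \<one> multiply like their maps, so Howie's theorem
    yields all of them from the collapses.\<close>
  have "{\<alpha> \<in> Sing n. (\<lambda>i\<in>{1..n}. \<one>, \<alpha>) \<in> S} = Sing n"
  proof (rule Howie_collapse_generate_Sing)
    show "collapse n q p \<in> {\<alpha> \<in> Sing n. (\<lambda>i\<in>{1..n}. \<one>, \<alpha>) \<in> S}"
      if "p \<in> {1..n}" "q \<in> {1..n}" "p \<noteq> q" for p q
      using E1 collapse_in_Sing that by simp
    fix \<alpha> \<beta> assume ab: "\<alpha> \<in> {\<alpha> \<in> Sing n. (\<lambda>i\<in>{1..n}. \<one>, \<alpha>) \<in> S}"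
      "\<beta> \<in> {\<alpha> \<in> Sing n. (\<lambda>i\<in>{1..n}. \<one>, \<alpha>) \<in> S}"
    have "wr_mult G n (\<lambda>i\<in>{1..n}. \<one>, \<alpha>) (\<lambda>i\<in>{1..n}. \<one>, \<beta>) \<in> S"
      using ab by (intro S_mult) auto
    moreover have "wr_mult G n (\<lambda>i\<in>{1..n}. \<one>, \<alpha>) (\<lambda>i\<in>{1..n}. \<one>, \<beta>)
      = (\<lambda>i\<in>{1..n}. \<one>, compose {1..n} \<beta> \<alpha>)"
      using ab Sing_mapsto[of \<alpha> n] by (auto simp: wr_mult_def fun_eq_iff restrict_def)
    ultimately show "compose {1..n} \<beta> \<alpha> \<in> {\<alpha> \<in> Sing n. (\<lambda>i\<in>{1..n}. \<one>, \<alpha>) \<in> S}"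
      using ab compose_Sing[of \<alpha> n \<beta>] by (simp add: Sing_iff_inj[of \<beta>])
  qed auto
  then have one: "(\<lambda>i\<in>{1..n}. \<one>, \<alpha>) \<in> S" if "\<alpha> \<in> Sing n" for \<alpha>
    using that by blast
  text \<open>Since \<open>q\<close> is not in the image of \<open>collapse n q p\<close>, coordinate \<open>j\<close> can be scaled while moving
    \<open>j\<close> to \<open>q\<close>, which is then moved back.\<close>
  have scale: "(\<lambda>i\<in>{1..n}. if collapse n q p i = j then a i \<otimes> m else a i, collapse n q p) \<in> S"
    if pq: "p \<in> {1..n}" "q \<in> {1..n}" "p \<noteq> q" and j: "j \<in> {1..n}" "j \<noteq> q"
      and a: "(a, collapse n q p) \<in> S" "a \<in> {1..n} \<rightarrow>\<^sub>E carrier G" and m: "m \<in> carrier G"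
    for p q j a m
  proof -
    have ac: "a i \<in> carrier G" if "i \<in> {1..n}" for i using PiE_mem[OF a(2) that] .
    have "wr_mult G n (wr_mult G n (a, collapse n q p) (\<lambda>i\<in>{1..n}. if i = j then m else \<one>, collapse n j q))
        (\<lambda>i\<in>{1..n}. \<one>, collapse n q j) \<in> S"
      using pq j m a(1) by (intro S_mult E E1) auto
    moreover have "wr_mult G n (wr_mult G n (a, collapse n q p)
          (\<lambda>i\<in>{1..n}. if i = j then m else \<one>, collapse n j q)) (\<lambda>i\<in>{1..n}. \<one>, collapse n q j)
      = (\<lambda>i\<in>{1..n}. if collapse n q p i = j then a i \<otimes> m else a i, collapse n q p)"
      using pq j m ac by (auto simp: wr_mult_def compose_def collapse_def fun_eq_iff restrict_def)
    ultimately show ?thesis by simp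
  qed
  have factor: "(a, \<alpha>) \<in> S" if a: "a \<in> {1..n} \<rightarrow>\<^sub>E carrier G" and \<alpha>: "\<alpha> \<in> Sing n"
    and pq: "p \<in> {1..n}" "q \<in> {1..n}" "p \<noteq> q" "\<alpha> p = \<alpha> q" and le: "L_le G (a q) (a p)"
    for a \<alpha> p q
  proof -
    obtain m where m: "m \<in> carrier G" "a q = m \<otimes> a p"
      using le by (auto simp: L_le_def)
    \<comment> \<open>The pair \<open>(a p, a q)\<close> is \<open>(\<one>, m)\<close> acted on by
      \<open>a p\<close>, and the idempotent with entry \<open>m\<close> at \<open>q\<close> carries
      this initial pair.\<close>
    have "(\<lambda>i\<in>{1..n}. if i = p then \<one> else if i = q then m else \<one>)
        = (\<lambda>i\<in>{1..n}. if i = q then m else \<one>)"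
      using pq by (auto simp: fun_eq_iff restrict_def)
    then have "(\<lambda>i\<in>{1..n}. if i = p then \<one> else if i = q then m else \<one>, collapse n q p) \<in> S"
      using E[OF pq(1-3) m(1)] by simp
    then have "(a, collapse n q p) \<in> S"
      using m pq PiE_mem[OF a pq(1)]
      by (intro collapse_span[OF _ _ _ _ a, where u=\<one> and v=m and c="a p"] scale) auto
    then have "wr_mult G n (a, collapse n q p) (\<lambda>i\<in>{1..n}. \<one>, \<alpha>) \<in> S"
      using one[OF \<alpha>] by (rule S_mult)
    then show ?thesis using \<alpha> pq a by (simp add: wr_mult_collapse)
  qed
  have "(a, \<alpha>) \<in> S" if a: "a \<in> {1..n} \<rightarrow>\<^sub>E carrier G" and \<alpha>: "\<alpha> \<in> Sing n" for a \<alpha>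
  proof -
    obtain p q where pq: "p \<in> {1..n}" "q \<in> {1..n}" "p \<noteq> q" "\<alpha> p = \<alpha> q"
      using \<alpha> by (auto simp: Sing_iff_inj inj_on_def)
    then have "L_le G (a q) (a p) \<or> L_le G (a p) (a q)"
      using L_chain_total[OF assms] PiE_mem[OF a] by blast
    \<comment> \<open>In the second case \<open>p\<close> and \<open>q\<close> exchange
      roles.\<close>
    then show ?thesis using factor[OF a \<alpha>] pq by metis
  qed
  then have "wr_Sing G n \<subseteq> S" by (auto simp: wr_Sing_def)
  moreover have E_sub: "?E \<subseteq> wr_Sing G n" by (auto simp: idempotents_def)
  moreover have "S \<subseteq> wr_Sing G n"
    unfolding S_def using E_sub wr_mult_closed[OF monoid_axioms] by (rule sgp_span_subset)
  ultimately show ?thesis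
    unfolding idempotent_generated_def sgp_generates_def S_def by blast
qed

end

text \<open>The diagonal action of a group preserves \<open>a b\<inverse>\<close>.\<close>
lemma (in group) diag_act_fin_gen_imp_finite:
  assumes "diag_act_fin_gen G"
  shows "finite (carrier G)"
proof -
  obtain \<Omega> where \<Omega>: "finite \<Omega>" "\<Omega> \<subseteq> carrier G \<times> carrier G"
      "{diag_act G p c | p c. p \<in> \<Omega> \<and> c \<in> carrier G} = carrier G \<times> carrier G"
    using assms by (auto simp: diag_act_fin_gen_def)
  have "carrier G \<subseteq> (\<lambda>(u, v). u \<otimes> inv v) ` \<Omega>"
  proof
    fix a assume a: "a \<in> carrier G"
    \<comment> \<open>The invariant of \<open>(a, \<one>)\<close> is \<open>a\<close> itself, so the
      finitely many invariants of \<Omega> exhaust the group.\<close>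
    then have "(a, \<one>) \<in> {diag_act G p c | p c. p \<in> \<Omega> \<and> c \<in> carrier G}"
      unfolding \<Omega>(3) by simp
    then obtain u v c where uvc: "(u, v) \<in> \<Omega>" "c \<in> carrier G" "a = u \<otimes> c" "\<one> = v \<otimes> c"
      by (auto simp: diag_act_def)
    then have "u \<in> carrier G" "v \<in> carrier G" using \<Omega>(2) by auto
    then have "c = inv v" using uvc by (metis inv_equality inv_inv inv_closed)
    then show "a \<in> (\<lambda>(u, v). u \<otimes> inv v) ` \<Omega>" using uvc by force
  qed
  then show ?thesis using \<Omega>(1) finite_surj by blast
qed

theorem theorem4p15:
  fixes M :: "('a, 'b) monoid_scheme" and n :: nat
  assumes "n \<ge> 2" and "monoid M"
  shows "(infinite (carrier M) \<longrightarrow>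
            (sgp_fin_gen (wr_Sing M n) (wr_mult M n) \<longleftrightarrow>
               sgp_fin_gen (carrier M) (mult M) \<and> diag_act_fin_gen M))
       \<and> (group M \<and> infinite (carrier M) \<longrightarrow>
            \<not> sgp_fin_gen (wr_Sing M n) (wr_mult M n))
       \<and> (\<not> sgp_fin_gen (wr_Sing M n) (wr_mult M n) \<longrightarrow>
            sgp_rank (wr_Sing M n) (wr_mult M n) =o |carrier M|
          \<and> (L_chain M \<longrightarrow>
               idempotent_generated (wr_Sing M n) (wr_mult M n)
             \<and> sgp_idrank (wr_Sing M n) (wr_mult M n) =o |carrier M| ))"
proof -
  interpret monoid M by (rule assms(2))
  let ?W = "wr_Sing M n" and ?f = "wr_mult M n"
  have fin_gen: "sgp_fin_gen ?W ?f \<longleftrightarrow> sgp_fin_gen (carrier M) (mult M) \<and> diag_act_fin_gen M"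
    using wr_Sing_fin_gen_imp_fin_gen wr_Sing_fin_gen_imp_diag_act_fin_gen
      fin_gen_imp_wr_Sing_fin_gen assms(1) by blast
  moreover have "\<not> sgp_fin_gen ?W ?f" if "group M" "infinite (carrier M)"
    using group.diag_act_fin_gen_imp_finite that fin_gen by blast
  moreover have "sgp_rank ?W ?f =o |carrier M|"
    and "L_chain M \<longrightarrow> idempotent_generated ?W ?f \<and> sgp_idrank ?W ?f =o |carrier M|"
    if nfg: "\<not> sgp_fin_gen ?W ?f"
  proof -
    \<comment> \<open>A finite \<open>M\<close> would make the wreath product finite, hence finitely
      generated.\<close>
    have "infinite (carrier M)" using wr_Sing_finite_fin_gen[OF assms(2)] nfg by blast
    then have card: "|?W| =o |carrier M|" by (rule card_of_wr_Sing[OF assms(1)])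
    have "sgp_generates ?W ?f ?W"
      using sgp_span_subset[of ?W ?W ?f] wr_mult_closed[OF assms(2)]
      by (auto simp: sgp_generates_def intro: sgp_span.incl)
    then show "sgp_rank ?W ?f =o |carrier M|"
      using sgp_rank_not_fin_gen nfg card ordIso_transitive by blast
    show "L_chain M \<longrightarrow> idempotent_generated ?W ?f \<and> sgp_idrank ?W ?f =o |carrier M|"
      using L_chain_imp_idempotent_generated sgp_idrank_not_fin_gen nfg card ordIso_transitive
      by blast
  qed
  ultimately show ?thesis by blast
qed

end
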